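(* Let $m\ge 3$ be an integer. For every irredundant cover $U$ of $G_m$, $$6|U|=3m^2-12m+32+4N_e-2E-s_{2,\mathrm{int}}+s_4.$$
   Context: For an integer $m\ge 2$, the grid is $G_m=\{1,\dots,m\}\times\{1,\dots,m\}$; its elements are called squares, and $(i,j)$ is the square in row $i$ and column $j$. For integers $1\le a,b\le m-1$, the card $C_{a,b}$ is the set $\{(a,b),(a+1,b),(a,b+1),(a+1,b+1)\}$, and $\mathcal C_m=\{C_{a,b}:1\le a,b\le m-1\}$. A configuration is a non-empty subset $U\subseteq\mathcal C_m$; its elements are the selected cards. The multiplicity of $x\in G_m$ is $\mu(x)=|\{C\in U: x\in C\}|$. A square $x$ is private for $C\in U$ if $x\in C$ and $\mu(x)=1$. $U$ is an irredundant cover of $G_m$ if $\mu(x)\ge 1$ for every $x\in G_m$ and every $C\in U$ contains at least one private square. The boundary squares are those $(i,j)\in G_m$ with $i\in\{1,m\}$ or $j\in\{1,m\}$; all other squares of $G_m$ are interior squares. A card $C_{a,b}$ is a boundary card if $a\in\{1,m-1\}$ or $b\in\{1,m-1\}$, and an interior card otherwise. The corner cards are $C_{1,1},C_{1,m-1},C_{m-1,1},C_{m-1,m-1}$. For a given $U$: $N_e$ is the number of selected boundary cards that are not corner cards; $N_{\mathrm{int}}$ is the number of selected interior cards; $s_{1,\mathrm{int}}$ is the number of interior squares $x$ with $\mu(x)=1$; $s_{2,\mathrm{int}}$ is the number of interior squares $x$ with $\mu(x)=2$; $s_4$ is the number of squares $x\in G_m$ with $\mu(x)=4$; and $E=s_{1,\mathrm{int}}-N_{\mathrm{int}}$.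 *)

theory Defs
  imports Main
begin

type_synonym square = "nat \<times> nat"

definition grid :: "nat \<Rightarrow> square set" where
  "grid m = {1..m} \<times> {1..m}"

(* The cards C_{a,b} are called blocks here, since "card" denotes cardinality in HOL;
   (i, j) is the square in row i and column j, both counted from 1. *)
definition block :: "nat \<Rightarrow> nat \<Rightarrow> square set" where
  "block a b = {(a, b), (a + 1, b), (a, b + 1), (a + 1, b + 1)}"

definition blocks :: "nat \<Rightarrow> square set set" where
  "blocks m = {block a b | a b. a \<in> {1..m - 1} \<and> b \<in> {1..m - 1}}"

definition configuration :: "nat \<Rightarrow> square set set \<Rightarrow> bool" where
  "configuration m U \<longleftrightarrow> U \<noteq> {} \<and> U \<subseteq> blocks m"

definition mult :: "square set set \<Rightarrow> square \<Rightarrow> nat" where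
  "mult U x = card {C \<in> U. x \<in> C}"

definition private_square :: "square set set \<Rightarrow> square set \<Rightarrow> square \<Rightarrow> bool" where
  "private_square U C x \<longleftrightarrow> x \<in> C \<and> mult U x = 1"

definition irredundant_cover :: "nat \<Rightarrow> square set set \<Rightarrow> bool" where
  "irredundant_cover m U \<longleftrightarrow>
     configuration m U \<and>
     (\<forall>x \<in> grid m. mult U x \<ge> 1) \<and>
     (\<forall>C \<in> U. \<exists>x. private_square U C x)"

definition boundary_squares :: "nat \<Rightarrow> square set" where
  "boundary_squares m = {(i, j) \<in> grid m. i \<in> {1, m} \<or> j \<in> {1, m}}"

definition interior_squares :: "nat \<Rightarrow> square set" where
  "interior_squares m = grid m - boundary_squares m"

definition boundary_blocks :: "nat \<Rightarrow> square set set" where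
  "boundary_blocks m =
     {block a b | a b. a \<in> {1..m - 1} \<and> b \<in> {1..m - 1} \<and>
                       (a \<in> {1, m - 1} \<or> b \<in> {1, m - 1})}"

definition interior_blocks :: "nat \<Rightarrow> square set set" where
  "interior_blocks m = blocks m - boundary_blocks m"

definition corner_blocks :: "nat \<Rightarrow> square set set" where
  "corner_blocks m = {block 1 1, block 1 (m - 1), block (m - 1) 1, block (m - 1) (m - 1)}"

definition N_e :: "nat \<Rightarrow> square set set \<Rightarrow> nat" where
  "N_e m U = card (U \<inter> (boundary_blocks m - corner_blocks m))"

definition N_int :: "nat \<Rightarrow> square set set \<Rightarrow> nat" where
  "N_int m U = card (U \<inter> interior_blocks m)"

definition s1_int :: "nat \<Rightarrow> square set set \<Rightarrow> nat" where
  "s1_int m U = card {x \<in> interior_squares m. mult U x = 1}"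

definition s2_int :: "nat \<Rightarrow> square set set \<Rightarrow> nat" where
  "s2_int m U = card {x \<in> interior_squares m. mult U x = 2}"

definition s4 :: "nat \<Rightarrow> square set set \<Rightarrow> nat" where
  "s4 m U = card {x \<in> grid m. mult U x = 4}"

definition excess :: "nat \<Rightarrow> square set set \<Rightarrow> int" where
  "excess m U = int (s1_int m U) - int (N_int m U)"

end

theory Submission
  imports Defs
begin

text \<open>
  The identity is a double count of the incidences between squares and selected cards, done
  twice: once over the whole grid and once over its boundary.

  Every card has four squares, so the multiplicities over the grid add up to \<open>4 |U|\<close>. Since each
  multiplicity \<open>\<mu>\<close> lies between 1 and 4, summing \<open>3 - \<mu>\<close> over the grid makes the squares of
  multiplicity 3 disappear and gives \<open>3 m\<^sup>2 - 4 |U| = 2 s\<^sub>1 + s\<^sub>2 - s\<^sub>4\<close>, where \<open>s\<^sub>k\<close> counts the squares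
  of multiplicity \<open>k\<close>.

  What remains is to express the boundary part of \<open>s\<^sub>1\<close> and \<open>s\<^sub>2\<close> through \<open>N\<^sub>e\<close>. A corner of the grid
  lies on a single card, so a cover selects all four corner cards. A corner card has three boundary
  squares, any other boundary card has two, and an interior card has none, so the multiplicities
  over the boundary add up to \<open>12 + 2 N\<^sub>e\<close>. A boundary square has multiplicity 1 or 2, and there are
  \<open>4 m - 4\<close> of them. These two linear equations determine the numbers of boundary squares of
  multiplicity 1 and of multiplicity 2. Substituting them together with
  \<open>|U| = 4 + N\<^sub>e + N\<^sub>i\<^sub>n\<^sub>t\<close> and \<open>E = s\<^sub>1\<^sub>,\<^sub>i\<^sub>n\<^sub>t - N\<^sub>i\<^sub>n\<^sub>t\<close> gives the formula.
\<close>

section \<open>Cards and their boundary squares\<close>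

lemma block_inject: "block a b = block c d \<longleftrightarrow> a = c \<and> b = d"
proof
  assume eq: "block a b = block c d"
  have "(a, b) \<in> block a b" "(c, d) \<in> block c d"
    by (simp_all add: block_def)
  with eq have "(a, b) \<in> block c d" "(c, d) \<in> block a b"
    by simp_all
  then show "a = c \<and> b = d"
    by (auto simp: block_def)
qed simp

lemma mem_block: "(i, j) \<in> block a b \<longleftrightarrow> (i = a \<or> i = a + 1) \<and> (j = b \<or> j = b + 1)"
  by (auto simp: block_def)

lemma card_block: "card (block a b) = 4"
  by (simp add: block_def)

lemma block_subset_grid:
  assumes "C \<in> blocks m"
  shows "C \<subseteq> grid m"
  using assms by (auto simp: blocks_def block_def grid_def)

lemma finite_blocks: "finite (blocks m)"
  unfolding blocks_def by (rule finite_image_set2) simp_all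

lemma finite_grid: "finite (grid m)"
  by (simp add: grid_def)

lemma boundary_squares_subset: "boundary_squares m \<subseteq> grid m"
  by (auto simp: boundary_squares_def)

lemma mem_boundary_squares:
  "(i, j) \<in> boundary_squares m \<longleftrightarrow>
     1 \<le> i \<and> i \<le> m \<and> 1 \<le> j \<and> j \<le> m \<and> (i = 1 \<or> i = m \<or> j = 1 \<or> j = m)"
  by (auto simp: boundary_squares_def grid_def)

lemma card_boundary_squares:
  assumes "m \<ge> 2"
  shows "card (boundary_squares m) = 4 * m - 4"
proof -
  have eq: "boundary_squares m = grid m - {2..m - 1} \<times> {2..m - 1}"
    using assms by (auto simp: boundary_squares_def grid_def)
  have "card (boundary_squares m) = m * m - (m - 2) * (m - 2)"
    unfolding eq using assms
    by (subst card_Diff_subset) (auto simp: grid_def)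
  moreover obtain k where "m = k + 2"
    using assms by (metis add.commute le_Suc_ex)
  ultimately show ?thesis
    by simp
qed

lemma card_corner_blocks:
  assumes "m \<ge> 3"
  shows "card (corner_blocks m) = 4"
proof -
  have "m - 1 \<noteq> 1" using assms by simp
  then show ?thesis
    by (simp only: corner_blocks_def) (simp add: block_inject del: One_nat_def)
qed

lemma corner_blocks_subset:
  assumes "m \<ge> 2"
  shows "corner_blocks m \<subseteq> boundary_blocks m"
proof -
  have "block a b \<in> boundary_blocks m" if "a \<in> {1, m - 1}" "b \<in> {1, m - 1}" for a b
    unfolding boundary_blocks_def using that assms by fastforce
  then show ?thesis by (simp add: corner_blocks_def)
qed

lemma boundary_squares_of_corner_block:
  assumes "m \<ge> 3" "C \<in> corner_blocks m"
  shows "card (C \<inter> boundary_squares m) = 3"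
proof -
  obtain n where m: "m = n + 3"
    using assms(1) by (metis add.commute le_Suc_ex)
  consider "C = block 1 1" | "C = block 1 (m - 1)" | "C = block (m - 1) 1" | "C = block (m - 1) (m - 1)"
    using assms(2) by (auto simp: corner_blocks_def)
  then show ?thesis
    by cases (simp_all add: m block_def mem_boundary_squares Int_insert_left)
qed

text \<open>
  A boundary card that is not a corner card touches exactly one side of the grid, because such a
  card exists only for \<open>m \<ge> 4\<close>, where opposite sides are out of reach of a single card.
\<close>

lemma boundary_squares_of_edge_block:
  assumes "C \<in> boundary_blocks m - corner_blocks m"
  shows "card (C \<inter> boundary_squares m) = 2"
proof -
  obtain a b where C: "C = block a b" and ab: "1 \<le> a" "a \<le> m - 1" "1 \<le> b" "b \<le> m - 1"
    and side: "a \<in> {1, m - 1} \<or> b \<in> {1, m - 1}"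
    using assms by (auto simp: boundary_blocks_def)
  have "\<not> (a \<in> {1, m - 1} \<and> b \<in> {1, m - 1})"
    using assms C by (auto simp: corner_blocks_def)
  with side consider "a = 1" "b \<noteq> 1" "b \<noteq> m - 1" | "a = m - 1" "b \<noteq> 1" "b \<noteq> m - 1"
    | "b = 1" "a \<noteq> 1" "a \<noteq> m - 1" | "b = m - 1" "a \<noteq> 1" "a \<noteq> m - 1"
    by blast
  moreover obtain n where m: "m = Suc n"
    using ab by (cases m) auto
  ultimately show ?thesis
    using ab by cases (simp_all add: C m block_def mem_boundary_squares Int_insert_left)
qed

lemma boundary_squares_of_interior_block:
  assumes "C \<in> interior_blocks m"
  shows "card (C \<inter> boundary_squares m) = 0"
proof -
  obtain a b where C: "C = block a b" and ab: "a \<in> {1..m - 1}" "b \<in> {1..m - 1}"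
    using assms by (auto simp: interior_blocks_def blocks_def)
  have "a \<notin> {1, m - 1}" "b \<notin> {1, m - 1}"
    using assms C ab by (auto simp: interior_blocks_def boundary_blocks_def)
  with ab have "block a b \<inter> boundary_squares m = {}"
    unfolding block_def by (auto simp: mem_boundary_squares)
  then show ?thesis by (simp add: C)
qed

section \<open>Multiplicities\<close>

lemma sum_mult:
  assumes "finite U" "finite A"
  shows "(\<Sum>x\<in>A. mult U x) = (\<Sum>C\<in>U. card (C \<inter> A))"
proof -
  have "(\<Sum>x\<in>A. mult U x) = (\<Sum>x\<in>A. \<Sum>C\<in>U. if x \<in> C then 1 else 0)"
    using assms by (simp add: mult_def sum.If_cases Int_def)
  also have "\<dots> = (\<Sum>C\<in>U. \<Sum>x\<in>A. if x \<in> C then 1 else 0)"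
    by (rule sum.swap)
  also have "\<dots> = (\<Sum>C\<in>U. card (C \<inter> A))"
    using assms by (simp add: sum.If_cases Int_def conj_commute)
  finally show ?thesis .
qed

text \<open>
  This is the common source of the upper bounds on multiplicities: the set \<open>S\<close> lists the positions
  whose cards can contain \<open>x\<close>.
\<close>

lemma mult_le_card_positions:
  assumes "finite S" "U \<subseteq> blocks m"
    and "\<And>a b. a \<in> {1..m - 1} \<Longrightarrow> b \<in> {1..m - 1} \<Longrightarrow> x \<in> block a b \<Longrightarrow> (a, b) \<in> S"
  shows "mult U x \<le> card S"
proof -
  have "{C \<in> U. x \<in> C} \<subseteq> (\<lambda>(a, b). block a b) ` S"
  proof
    fix C assume C: "C \<in> {C \<in> U. x \<in> C}"
    then obtain a b where "C = block a b" "a \<in> {1..m - 1}" "b \<in> {1..m - 1}"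
      using assms(2) by (auto simp: blocks_def)
    with C assms(3) show "C \<in> (\<lambda>(a, b). block a b) ` S"
      by force
  qed
  then have "mult U x \<le> card ((\<lambda>(a, b). block a b) ` S)"
    unfolding mult_def using assms(1) by (intro card_mono) auto
  also have "\<dots> \<le> card S"
    using assms(1) by (rule card_image_le)
  finally show ?thesis .
qed

lemma mult_le_4:
  assumes "U \<subseteq> blocks m"
  shows "mult U x \<le> 4"
proof -
  obtain i j where x: "x = (i, j)" by (cases x)
  have "mult U x \<le> card ({i - 1, i} \<times> {j - 1, j})"
    by (rule mult_le_card_positions[OF _ assms]) (auto simp: x mem_block)
  also have "\<dots> \<le> 2 * 2"
    unfolding card_cartesian_product by (intro mult_le_mono) (simp_all add: card_insert_if)
  finally show ?thesis by simp
qed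

lemma mult_boundary_le_2:
  assumes "U \<subseteq> blocks m" "x \<in> boundary_squares m"
  shows "mult U x \<le> 2"
proof -
  obtain i j where x: "x = (i, j)" by (cases x)
  consider "i = 1" | "i = m" | "j = 1" | "j = m"
    using assms(2) by (auto simp: x mem_boundary_squares)
  then obtain S where S: "finite S" "card S \<le> 2"
    "\<And>a b. a \<in> {1..m - 1} \<Longrightarrow> b \<in> {1..m - 1} \<Longrightarrow> x \<in> block a b \<Longrightarrow> (a, b) \<in> S"
  proof cases
    case 1
    then show ?thesis
      by (intro that[of "{(1, j - 1), (1, j)}"]) (auto simp: x mem_block card_insert_if)
  next
    case 2
    then show ?thesis
      by (intro that[of "{(m - 1, j - 1), (m - 1, j)}"]) (auto simp: x mem_block card_insert_if)
  next
    case 3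
    then show ?thesis
      by (intro that[of "{(i - 1, 1), (i, 1)}"]) (auto simp: x mem_block card_insert_if)
  next
    case 4
    then show ?thesis
      by (intro that[of "{(i - 1, m - 1), (i, m - 1)}"]) (auto simp: x mem_block card_insert_if)
  qed
  have "mult U x \<le> card S"
    by (rule mult_le_card_positions[OF S(1) assms(1)]) (rule S(3))
  with S(2) show ?thesis by linarith
qed

text \<open>
  Each corner square of the grid lies on exactly one card, so covering it forces that card.
\<close>

lemma corner_blocks_selected:
  assumes "m \<ge> 2" "U \<subseteq> blocks m" "\<forall>x \<in> grid m. mult U x \<ge> 1"
  shows "corner_blocks m \<subseteq> U"
proof -
  have selected: "block a b \<in> U"
    if x: "x \<in> grid m"
      and unique: "\<And>c d. c \<in> {1..m - 1} \<Longrightarrow> d \<in> {1..m - 1} \<Longrightarrow> x \<in> block c d \<Longrightarrow> c = a \<and> d = b"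
    for x a b
  proof -
    have "{C \<in> U. x \<in> C} \<noteq> {}"
      using assms(3) x unfolding mult_def by (metis card.empty not_one_le_zero)
    then obtain C where "C \<in> U" "x \<in> C"
      by blast
    moreover from this obtain c d where "C = block c d" "c \<in> {1..m - 1}" "d \<in> {1..m - 1}"
      using assms(2) unfolding blocks_def by blast
    ultimately show ?thesis
      using unique by blast
  qed
  have "block 1 1 \<in> U"
    by (rule selected[of "(1, 1)"]) (use assms(1) in \<open>auto simp: grid_def mem_block\<close>)
  moreover have "block 1 (m - 1) \<in> U"
    by (rule selected[of "(1, m)"]) (use assms(1) in \<open>auto simp: grid_def mem_block\<close>)
  moreover have "block (m - 1) 1 \<in> U"
    by (rule selected[of "(m, 1)"]) (use assms(1) in \<open>auto simp: grid_def mem_block\<close>)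
  moreover have "block (m - 1) (m - 1) \<in> U"
    by (rule selected[of "(m, m)"]) (use assms(1) in \<open>auto simp: grid_def mem_block\<close>)
  ultimately show ?thesis
    by (simp add: corner_blocks_def)
qed

section \<open>The counting identity\<close>

lemma card_eq_sum_indicator:
  assumes "finite A"
  shows "int (card {x \<in> A. P x}) = (\<Sum>x\<in>A. if P x then 1 else 0)"
  using assms by (simp add: sum.If_cases Int_def)

theorem theorem3p6:
  fixes m :: nat and U :: "square set set"
  assumes "m \<ge> 3"
    and "irredundant_cover m U"
  shows "6 * int (card U) =
           3 * (int m)^2 - 12 * int m + 32 + 4 * int (N_e m U)
           - 2 * excess m U - int (s2_int m U) + int (s4 m U)"
proof -
  have sub: "U \<subseteq> blocks m" and cover: "\<forall>x \<in> grid m. mult U x \<ge> 1"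
    using assms(2) by (auto simp: irredundant_cover_def configuration_def)
  have m2: "m \<ge> 2" using assms(1) by simp
  have finU: "finite U"
    using sub finite_blocks by (rule finite_subset)
  define B where "B = boundary_squares m"
  define I where "I = interior_squares m"
  have BI: "grid m = B \<union> I" "B \<inter> I = {}" "finite B" "finite I"
    using boundary_squares_subset[of m] finite_grid[of m]
    by (auto simp: B_def I_def interior_squares_def intro: finite_subset)
  define b where "b k = int (card {x \<in> B. mult U x = k})" for k

  define K where "K = corner_blocks m"
  define D where "D = U \<inter> (boundary_blocks m - corner_blocks m)"
  define J where "J = U \<inter> interior_blocks m"
  have U: "U = K \<union> (D \<union> J)"
    using sub corner_blocks_selected[OF m2 sub cover]
    by (auto simp: K_def D_def J_def interior_blocks_def)
  have disj: "K \<inter> (D \<union> J) = {}" "D \<inter> J = {}"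
    using corner_blocks_subset[OF m2] by (auto simp: K_def D_def J_def interior_blocks_def)
  have fin: "finite K" "finite D" "finite J"
    using finU U by (auto intro: finite_subset)
  have cardK: "card K = 4"
    unfolding K_def by (rule card_corner_blocks[OF assms(1)])
  have cardU: "int (card U) = 4 + int (N_e m U) + int (N_int m U)"
    using fin disj cardK
    by (subst U) (simp add: card_Un_disjoint N_e_def N_int_def flip: D_def J_def)

  have "(\<Sum>x\<in>B. mult U x) = (\<Sum>C\<in>U. card (C \<inter> B))"
    by (rule sum_mult[OF finU BI(3)])
  also have "\<dots> = (\<Sum>C\<in>K. card (C \<inter> B)) + ((\<Sum>C\<in>D. card (C \<inter> B)) + (\<Sum>C\<in>J. card (C \<inter> B)))"
    using fin disj by (subst U) (simp add: sum.union_disjoint)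
  also have "(\<Sum>C\<in>K. card (C \<inter> B)) = (\<Sum>C\<in>K. 3)"
    unfolding K_def B_def
    by (intro sum.cong refl boundary_squares_of_corner_block assms(1))
  also have "(\<Sum>C\<in>D. card (C \<inter> B)) = (\<Sum>C\<in>D. 2)"
    unfolding D_def B_def by (intro sum.cong refl boundary_squares_of_edge_block) auto
  also have "(\<Sum>C\<in>J. card (C \<inter> B)) = (\<Sum>C\<in>J. 0)"
    unfolding J_def B_def by (intro sum.cong refl boundary_squares_of_interior_block) auto
  finally have "(\<Sum>x\<in>B. mult U x) = 12 + 2 * N_e m U"
    by (simp add: cardK N_e_def flip: D_def)
  then have sumB: "(\<Sum>x\<in>B. int (mult U x)) = 12 + 2 * int (N_e m U)"
    by (simp flip: of_nat_sum)

  have multB: "mult U x = 1 \<or> mult U x = 2" if "x \<in> B" for x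
    using mult_boundary_le_2[OF sub] cover that boundary_squares_subset[of m]
    unfolding B_def by (metis One_nat_def Suc_1 le_SucE le_antisym subsetD)
  have "(\<Sum>x\<in>B. int (mult U x)) =
      (\<Sum>x\<in>B. (if mult U x = 1 then 1 else 0) + 2 * (if mult U x = 2 then 1 else 0))"
    using multB by (intro sum.cong) auto
  then have b12: "b 1 + 2 * b 2 = 12 + 2 * int (N_e m U)"
    using BI(3) sumB
    by (simp add: b_def card_eq_sum_indicator sum.distrib flip: sum_distrib_left)
  have "int (card B) = (\<Sum>x\<in>B. (if mult U x = 1 then 1 else 0) + (if mult U x = 2 then 1 else 0))"
    using multB by (simp only: card_eq_sum of_nat_sum, intro sum.cong) auto
  then have b1_b2: "b 1 + b 2 = 4 * int m - 4"
    using BI(3) card_boundary_squares[OF m2] m2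
    by (simp add: b_def card_eq_sum_indicator sum.distrib flip: B_def)

  have "(\<Sum>x\<in>grid m. mult U x) = (\<Sum>C\<in>U. card (C \<inter> grid m))"
    by (rule sum_mult[OF finU finite_grid])
  also have "\<dots> = (\<Sum>C\<in>U. 4)"
  proof (intro sum.cong refl)
    fix C assume "C \<in> U"
    then have "C \<in> blocks m" using sub by blast
    then show "card (C \<inter> grid m) = 4"
      using block_subset_grid[of C m] by (auto simp: blocks_def card_block Int_absorb2)
  qed
  finally have "(\<Sum>x\<in>grid m. mult U x) = 4 * card U" by simp
  then have sumG: "(\<Sum>x\<in>grid m. int (mult U x)) = 4 * int (card U)"
    by (simp flip: of_nat_sum)

  \<comment> \<open>The weight \<open>3 - \<mu>\<close> vanishes at multiplicity 3, a count that the formula does not mention.\<close>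
  have weight: "3 - int (mult U x) =
      2 * (if mult U x = 1 then 1 else 0) + (if mult U x = 2 then 1 else 0)
      - (if mult U x = 4 then 1 else 0)" if "x \<in> grid m" for x
  proof -
    have "mult U x \<in> {1, 2, 3, 4}"
      using mult_le_4[OF sub, of x] cover that by force
    then show ?thesis by auto
  qed
  have "3 * (int m)^2 - 4 * int (card U) = (\<Sum>x\<in>grid m. 3 - int (mult U x))"
    by (simp add: sum_subtractf sumG) (simp add: grid_def power2_eq_square)
  also have "\<dots> = (\<Sum>x\<in>grid m. 2 * (if mult U x = 1 then 1 else 0)
      + (if mult U x = 2 then 1 else 0) - (if mult U x = 4 then 1 else 0))"
    using weight by (rule sum.cong[OF refl])
  also have "\<dots> = 2 * int (card {x \<in> grid m. mult U x = 1})
      + int (card {x \<in> grid m. mult U x = 2}) - int (s4 m U)"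
    by (simp add: s4_def card_eq_sum_indicator finite_grid sum.distrib sum_subtractf
        flip: sum_distrib_left)
  finally have total: "3 * (int m)^2 - 4 * int (card U) = 2 * int (card {x \<in> grid m. mult U x = 1})
      + int (card {x \<in> grid m. mult U x = 2}) - int (s4 m U)" .

  have split: "int (card {x \<in> grid m. mult U x = k}) = b k + int (card {x \<in> I. mult U x = k})" for k
  proof -
    have "{x \<in> grid m. mult U x = k} = {x \<in> B. mult U x = k} \<union> {x \<in> I. mult U x = k}"
      using BI(1) by auto
    moreover have "{x \<in> B. mult U x = k} \<inter> {x \<in> I. mult U x = k} = {}"
      using BI(2) by auto
    ultimately show ?thesis
      using BI(3,4) by (simp add: b_def card_Un_disjoint)
  qed
  show ?thesis
    using total b12 b1_b2 cardU split[of 1] split[of 2]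
    by (simp add: excess_def s1_int_def s2_int_def flip: I_def)
qed

end
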